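(* Let $\mathcal D_0$ be the second order Dunkl shift operator acting on functions $f(x)$ by $$\mathcal D_0=A(x)\,T^{+}+B(x)\,T^{-}+C(x)\,R+D(x)\,T^{+}R-\big(A(x)+B(x)+C(x)+D(x)\big)\mathbb I,$$ where $T^{\pm}f(x)=f(x\pm1)$, $Rf(x)=f(-x)$ (so $T^{+}Rf(x)=f(-x-1)$), with coefficients $$A(x)=\frac{(x+\rho_1+1)(x+\rho_2+1)(2x-2r_1+1)(2x-2r_2+1)}{8(x+1)(2x+1)},$$ $$B(x)=\frac{(x-\rho_2)(x-\rho_1-1)(2x+2r_1-1)(2x+2r_2-1)}{8x(2x-1)},$$ $$C(x)=\frac{(x-\rho_2)(4x^2+\omega)}{8x}-\frac{(x-\rho_2)(x+\rho_1+1)(2x-2r_1+1)(2x-2r_2+1)}{8x(2x+1)}-B(x),$$ $$D(x)=\frac{\rho_2(x+\rho_1+1)(2x-2r_1+1)(2x-2r_2+1)}{8x(x+1)(2x+1)},$$ and $\omega=4\rho_1-4(r_1+r_2)\rho_1+4r_1r_2-6(r_1+r_2)+5$. Let $\alpha\in\mathbb C$ and let $I_n(x)=I_n(x;\rho_1,\rho_2,r_1,r_2)$ be the monic complementary Bannai--Ito polynomials. Define $$\mathcal D_\alpha=\mathcal D_0+\alpha\,\frac{(x-\rho_2)}{2x}(\mathbb I-R).$$ Then for all $n\ge 0$ $$\mathcal D_\alpha I_n(x)=\Lambda_n^{(\alpha)}I_n(x),$$ where, with $g=\rho_1+\rho_2-r_1-r_2$, the eigenvalues are $$\Lambda_{2n}^{(\alpha)}=n^2+(g+1)n,\qquad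 \Lambda_{2n+1}^{(\alpha)}=n^2+(g+2)n+\alpha .$$
   Context: Let $g=\rho_1+\rho_2-r_1-r_2$. The monic Bannai--Ito polynomials $B_n(x)$ are defined by $B_{-1}=0$, $B_0=1$ and $$B_{n+1}(x)+(\rho_1-A_n-C_n)B_n(x)+A_{n-1}C_nB_{n-1}(x)=xB_n(x),$$ with $$A_n=\begin{cases}\dfrac{(n+2\rho_1-2r_1+1)(n+2\rho_1-2r_2+1)}{4(n+g+1)},& n\text{ even},\\[2mm] \dfrac{(n+2g+1)(n+2\rho_1+2\rho_2+1)}{4(n+g+1)},& n\text{ odd},\end{cases}$$ $$C_n=\begin{cases}-\dfrac{n(n-2r_1-2r_2)}{4(n+g)},& n\text{ even},\\[2mm] -\dfrac{(n+2\rho_2-2r_2)(n+2\rho_2-2r_1)}{4(n+g)},& n\text{ odd},\end{cases}$$ and $C_0=0$. The complementary Bannai--Ito polynomials are the monic polynomials of degree $n$ defined by $$I_n(x)=\frac{B_{n+1}(x)-A_nB_n(x)}{x-\rho_1}.$$ The parameters $\rho_1,\rho_2,r_1,r_2$ are such that the denominators in these recurrence coefficients do not vanish. $\mathbb I$ denotes the identity operator. The scalar coefficients $A(x),B(x),C(x),D(x)$ (functions of $x$) are unrelated to the recurrence coefficients $A_n,C_n$. *)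

theory Defs
  imports Complex_Main "HOL-Computational_Algebra.Polynomial"
begin

definition BI_g :: "complex \<Rightarrow> complex \<Rightarrow> complex \<Rightarrow> complex \<Rightarrow> complex" where
  "BI_g \<rho>1 \<rho>2 r1 r2 = \<rho>1 + \<rho>2 - r1 - r2"

definition BI_A :: "complex \<Rightarrow> complex \<Rightarrow> complex \<Rightarrow> complex \<Rightarrow> nat \<Rightarrow> complex" where
  "BI_A \<rho>1 \<rho>2 r1 r2 n =
     (let g = BI_g \<rho>1 \<rho>2 r1 r2 in
      if even n
      then (of_nat n + 2 * \<rho>1 - 2 * r1 + 1) * (of_nat n + 2 * \<rho>1 - 2 * r2 + 1)
             / (4 * (of_nat n + g + 1))
      else (of_nat n + 2 * g + 1) * (of_nat n + 2 * \<rho>1 + 2 * \<rho>2 + 1)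
             / (4 * (of_nat n + g + 1)))"

definition BI_C :: "complex \<Rightarrow> complex \<Rightarrow> complex \<Rightarrow> complex \<Rightarrow> nat \<Rightarrow> complex" where
  "BI_C \<rho>1 \<rho>2 r1 r2 n =
     (let g = BI_g \<rho>1 \<rho>2 r1 r2 in
      if n = 0 then 0
      else if even n
      then - (of_nat n * (of_nat n - 2 * r1 - 2 * r2) / (4 * (of_nat n + g)))
      else - ((of_nat n + 2 * \<rho>2 - 2 * r2) * (of_nat n + 2 * \<rho>2 - 2 * r1)
             / (4 * (of_nat n + g))))"

(* Every denominator of A n (n \<ge> 0) and of C n (n \<ge> 1) has the form 4 * (m + g) with m \<ge> 1;
   C 0 = 0 is a convention and imposes no condition on g. *)
definition BI_admissible :: "complex \<Rightarrow> complex \<Rightarrow> complex \<Rightarrow> complex \<Rightarrow> bool" where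
  "BI_admissible \<rho>1 \<rho>2 r1 r2 \<longleftrightarrow>
     (\<forall>n::nat. of_nat n + BI_g \<rho>1 \<rho>2 r1 r2 + 1 \<noteq> 0) \<and>
     (\<forall>n::nat. n \<ge> 1 \<longrightarrow> of_nat n + BI_g \<rho>1 \<rho>2 r1 r2 \<noteq> 0)"

(* The three-term recurrence solved for its leading term; the second equation is the case n = 0,
   where the term with index -1 vanishes. *)
fun BI_poly :: "complex \<Rightarrow> complex \<Rightarrow> complex \<Rightarrow> complex \<Rightarrow> nat \<Rightarrow> complex poly" where
  "BI_poly \<rho>1 \<rho>2 r1 r2 0 = 1"
| "BI_poly \<rho>1 \<rho>2 r1 r2 (Suc 0) =
     [:- (\<rho>1 - BI_A \<rho>1 \<rho>2 r1 r2 0 - BI_C \<rho>1 \<rho>2 r1 r2 0), 1:]"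
| "BI_poly \<rho>1 \<rho>2 r1 r2 (Suc (Suc n)) =
     [:- (\<rho>1 - BI_A \<rho>1 \<rho>2 r1 r2 (Suc n) - BI_C \<rho>1 \<rho>2 r1 r2 (Suc n)), 1:]
         * BI_poly \<rho>1 \<rho>2 r1 r2 (Suc n)
     - smult (BI_A \<rho>1 \<rho>2 r1 r2 n * BI_C \<rho>1 \<rho>2 r1 r2 (Suc n)) (BI_poly \<rho>1 \<rho>2 r1 r2 n)"

(* The polynomial division is exact, see CBI_poly_times. *)
definition CBI_poly :: "complex \<Rightarrow> complex \<Rightarrow> complex \<Rightarrow> complex \<Rightarrow> nat \<Rightarrow> complex poly" where
  "CBI_poly \<rho>1 \<rho>2 r1 r2 n =
     (BI_poly \<rho>1 \<rho>2 r1 r2 (Suc n) - smult (BI_A \<rho>1 \<rho>2 r1 r2 n) (BI_poly \<rho>1 \<rho>2 r1 r2 n))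
       div [:- \<rho>1, 1:]"

lemma BI_poly_at_rho1:
  "poly (BI_poly \<rho>1 \<rho>2 r1 r2 (Suc n)) \<rho>1
     = BI_A \<rho>1 \<rho>2 r1 r2 n * poly (BI_poly \<rho>1 \<rho>2 r1 r2 n) \<rho>1"
proof (induction n)
  case 0
  then show ?case by (simp add: BI_C_def)
next
  case (Suc n)
  then show ?case by (simp add: algebra_simps)
qed

lemma CBI_poly_times:
  "[:- \<rho>1, 1:] * CBI_poly \<rho>1 \<rho>2 r1 r2 n
     = BI_poly \<rho>1 \<rho>2 r1 r2 (Suc n) - smult (BI_A \<rho>1 \<rho>2 r1 r2 n) (BI_poly \<rho>1 \<rho>2 r1 r2 n)"
proof -
  have "[:- \<rho>1, 1:] dvd
      BI_poly \<rho>1 \<rho>2 r1 r2 (Suc n) - smult (BI_A \<rho>1 \<rho>2 r1 r2 n) (BI_poly \<rho>1 \<rho>2 r1 r2 n)"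
    using BI_poly_at_rho1 by (simp add: poly_eq_0_iff_dvd [symmetric] del: BI_poly.simps)
  then show ?thesis
    unfolding CBI_poly_def by (rule dvd_mult_div_cancel)
qed

definition Tplus :: "(complex \<Rightarrow> complex) \<Rightarrow> complex \<Rightarrow> complex" where
  "Tplus f x = f (x + 1)"

definition Tminus :: "(complex \<Rightarrow> complex) \<Rightarrow> complex \<Rightarrow> complex" where
  "Tminus f x = f (x - 1)"

definition Rop :: "(complex \<Rightarrow> complex) \<Rightarrow> complex \<Rightarrow> complex" where
  "Rop f x = f (- x)"

definition coeff_A :: "complex \<Rightarrow> complex \<Rightarrow> complex \<Rightarrow> complex \<Rightarrow> complex \<Rightarrow> complex" where
  "coeff_A \<rho>1 \<rho>2 r1 r2 x =
     (x + \<rho>1 + 1) * (x + \<rho>2 + 1) * (2 * x - 2 * r1 + 1) * (2 * x - 2 * r2 + 1)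
       / (8 * (x + 1) * (2 * x + 1))"

definition coeff_B :: "complex \<Rightarrow> complex \<Rightarrow> complex \<Rightarrow> complex \<Rightarrow> complex \<Rightarrow> complex" where
  "coeff_B \<rho>1 \<rho>2 r1 r2 x =
     (x - \<rho>2) * (x - \<rho>1 - 1) * (2 * x + 2 * r1 - 1) * (2 * x + 2 * r2 - 1)
       / (8 * x * (2 * x - 1))"

definition CBI_omega :: "complex \<Rightarrow> complex \<Rightarrow> complex \<Rightarrow> complex" where
  "CBI_omega \<rho>1 r1 r2 = 4 * \<rho>1 - 4 * (r1 + r2) * \<rho>1 + 4 * r1 * r2 - 6 * (r1 + r2) + 5"

definition coeff_C :: "complex \<Rightarrow> complex \<Rightarrow> complex \<Rightarrow> complex \<Rightarrow> complex \<Rightarrow> complex" where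
  "coeff_C \<rho>1 \<rho>2 r1 r2 x =
     (x - \<rho>2) * (4 * x ^ 2 + CBI_omega \<rho>1 r1 r2) / (8 * x)
     - (x - \<rho>2) * (x + \<rho>1 + 1) * (2 * x - 2 * r1 + 1) * (2 * x - 2 * r2 + 1)
         / (8 * x * (2 * x + 1))
     - coeff_B \<rho>1 \<rho>2 r1 r2 x"

definition coeff_D :: "complex \<Rightarrow> complex \<Rightarrow> complex \<Rightarrow> complex \<Rightarrow> complex \<Rightarrow> complex" where
  "coeff_D \<rho>1 \<rho>2 r1 r2 x =
     \<rho>2 * (x + \<rho>1 + 1) * (2 * x - 2 * r1 + 1) * (2 * x - 2 * r2 + 1)
       / (8 * x * (x + 1) * (2 * x + 1))"

definition dunkl_D0 ::
  "complex \<Rightarrow> complex \<Rightarrow> complex \<Rightarrow> complex \<Rightarrow> (complex \<Rightarrow> complex) \<Rightarrow> complex \<Rightarrow> complex" where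
  "dunkl_D0 \<rho>1 \<rho>2 r1 r2 f x =
     coeff_A \<rho>1 \<rho>2 r1 r2 x * Tplus f x
     + coeff_B \<rho>1 \<rho>2 r1 r2 x * Tminus f x
     + coeff_C \<rho>1 \<rho>2 r1 r2 x * Rop f x
     + coeff_D \<rho>1 \<rho>2 r1 r2 x * Tplus (Rop f) x
     - (coeff_A \<rho>1 \<rho>2 r1 r2 x + coeff_B \<rho>1 \<rho>2 r1 r2 x
        + coeff_C \<rho>1 \<rho>2 r1 r2 x + coeff_D \<rho>1 \<rho>2 r1 r2 x) * f x"

definition dunkl_D ::
  "complex \<Rightarrow> complex \<Rightarrow> complex \<Rightarrow> complex \<Rightarrow> complex \<Rightarrow> (complex \<Rightarrow> complex) \<Rightarrow> complex \<Rightarrow> complex" where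
  "dunkl_D \<alpha> \<rho>1 \<rho>2 r1 r2 f x =
     dunkl_D0 \<rho>1 \<rho>2 r1 r2 f x + \<alpha> * ((x - \<rho>2) / (2 * x)) * (f x - Rop f x)"

(* The poles of the coefficient functions. *)
definition dunkl_poles :: "complex set" where
  "dunkl_poles = {0, -1, 1/2, -1/2}"

definition CBI_eigenvalue :: "complex \<Rightarrow> complex \<Rightarrow> complex \<Rightarrow> complex \<Rightarrow> complex \<Rightarrow> nat \<Rightarrow> complex" where
  "CBI_eigenvalue \<alpha> \<rho>1 \<rho>2 r1 r2 k =
     (let g = BI_g \<rho>1 \<rho>2 r1 r2; n = of_nat (k div 2) in
      if even k then n ^ 2 + (g + 1) * n
      else n ^ 2 + (g + 2) * n + \<alpha>)"

end

theory Submission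
  imports Defs
begin

text \<open>
  The operator \<open>\<D>\<^sub>\<alpha>\<close> becomes classical once the reflection is removed by parity. The
  complementary polynomials satisfy
  \<open>I\<^sub>n\<^sub>+\<^sub>1 = (x - (-1)\<^sup>n \<rho>\<^sub>2) I\<^sub>n - \<tau>\<^sub>n I\<^sub>n\<^sub>-\<^sub>1\<close> with \<open>\<tau>\<^sub>n = A\<^sub>n C\<^sub>n\<close>, hence
  \<open>I\<^sub>2\<^sub>n = R\<^sub>n\<close> and \<open>I\<^sub>2\<^sub>n\<^sub>+\<^sub>1 = (x - \<rho>\<^sub>2) Q\<^sub>n\<close> with \<open>R\<^sub>n\<close> and \<open>Q\<^sub>n\<close> even in \<open>x\<close>
  (\<open>CBI_poly_eq_wilson\<close>). On even functions \<open>\<D>\<^sub>\<alpha>\<close> coincides with the second order difference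
  operator \<open>L\<^sub>b\<close> of the Wilson polynomials with parameters \<open>a = \<rho>\<^sub>1 + 1\<close>, \<open>b = \<rho>\<^sub>2\<close>,
  \<open>c = 1/2 - r\<^sub>1\<close>, \<open>d = 1/2 - r\<^sub>2\<close> (\<open>dunkl_D_even\<close>); on \<open>x - \<rho>\<^sub>2\<close> times an even function it
  acts, behind this factor, as \<open>L\<^sub>b\<^sub>+\<^sub>1 + \<alpha>\<close> (\<open>dunkl_D_odd\<close>). So \<open>R\<^sub>n\<close> and \<open>Q\<^sub>n\<close> must be
  eigenfunctions of two Wilson operators which differ by a unit shift of \<open>b\<close>.

  These two families are coupled by the relations
  \<open>R\<^sub>n\<^sub>+\<^sub>1 = (x\<^sup>2 - b\<^sup>2) Q\<^sub>n - \<tau>\<^sub>2\<^sub>n\<^sub>+\<^sub>1 R\<^sub>n\<close> and \<open>Q\<^sub>n = R\<^sub>n - \<tau>\<^sub>2\<^sub>n Q\<^sub>n\<^sub>-\<^sub>1\<close>. To prove both eigenvalue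
  equations by one induction on \<open>n\<close> it is enough to know how far the operators are from commuting
  with the coupling, that is, how the two first order operators
  \<open>E = L\<^sub>b\<^sub>+\<^sub>1 - L\<^sub>b\<close> and \<open>F = L\<^sub>b \<circ> (x\<^sup>2 - b\<^sup>2) - (x\<^sup>2 - b\<^sup>2) \<circ> L\<^sub>b\<^sub>+\<^sub>1\<close> act. The eigenvalue equations force
  \<^item> \<open>E R\<^sub>n = (2n + s - 1) Q\<^sub>n - (n + s - 1) R\<^sub>n\<close> and
  \<^item> \<open>F Q\<^sub>n = (2n + s) R\<^sub>n\<^sub>+\<^sub>1 - n (x\<^sup>2 - b\<^sup>2) Q\<^sub>n\<close>, where \<open>s = a + b + c + d\<close>.

  With these two relations added, the induction closes, because \<open>F\<close> is \<open>(x\<^sup>2 - b\<^sup>2) E\<close>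
  up to a multiple of \<open>L\<^sub>b\<close> and a polynomial (\<open>F_eq\<close>), and \<open>E \<circ> (x\<^sup>2 - b\<^sup>2)\<close> is \<open>F\<close> up to a
  multiple of \<open>L\<^sub>b\<^sub>+\<^sub>1\<close> and a polynomial (\<open>E_mult_eq\<close>). The explicit form of the
  coefficients \<open>\<tau>\<^sub>n\<close> enters only through two relations between neighbouring ones, \<open>tau_odd_step\<close>
  and \<open>tau_even_step\<close>. The difference operators are never composed with one another, so
  everything takes place at a single point \<open>x\<close> away from the poles.
\<close>

section \<open>Two coupled families of Wilson polynomials\<close>

text \<open>
  The assumption makes every denominator of \<open>\<tau>_even (Suc n)\<close> and \<open>\<tau>_odd n\<close> below nonzero.
\<close>
locale wilson =
  fixes a b c d :: complex
  assumes denom: "\<And>n::nat. of_nat n + (a + b + c + d) - 1 \<noteq> 0"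
begin

abbreviation s :: complex where "s \<equiv> a + b + c + d"

definition weight :: "complex \<Rightarrow> complex" where
  "weight x = (x + a) * (x + c) * (x + d) / (2 * x * (2 * x + 1))"

text \<open>
  The coefficients \<open>\<tau>\<^sub>2\<^sub>n = A\<^sub>2\<^sub>n C\<^sub>2\<^sub>n\<close> and \<open>\<tau>\<^sub>2\<^sub>n\<^sub>+\<^sub>1 = A\<^sub>2\<^sub>n\<^sub>+\<^sub>1 C\<^sub>2\<^sub>n\<^sub>+\<^sub>1\<close> in Wilson parameters. The
  factor \<open>n\<close> makes \<open>\<tau>_even 0\<close> vanish for every \<open>s\<close>.
\<close>
definition \<tau>_even :: "nat \<Rightarrow> complex" where
  "\<tau>_even n = - (of_nat n * (of_nat n + a + c - 1) * (of_nat n + a + d - 1) * (of_nat n + c + d - 1)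
     / ((2 * of_nat n + s - 1) * (2 * of_nat n + s - 2)))"

definition \<tau>_odd :: "nat \<Rightarrow> complex" where
  "\<tau>_odd n = - ((of_nat n + s - 1) * (of_nat n + a + b) * (of_nat n + b + c) * (of_nat n + b + d)
     / ((2 * of_nat n + s) * (2 * of_nat n + s - 1)))"

text \<open>
  In the last equation \<open>R (Suc n) x\<close> is written out in order that the recursion descends in \<open>n\<close>;
  \<open>Q_Suc\<close> is the intended form.
\<close>
fun R Q :: "nat \<Rightarrow> complex \<Rightarrow> complex" where
  "R 0 x = 1"
| "R (Suc n) x = (x\<^sup>2 - b\<^sup>2) * Q n x - \<tau>_odd n * R n x"
| "Q 0 x = 1"
| "Q (Suc n) x = (x\<^sup>2 - b\<^sup>2) * Q n x - \<tau>_odd n * R n x - \<tau>_even (Suc n) * Q n x"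

lemma Q_Suc: "Q (Suc n) x = R (Suc n) x - \<tau>_even (Suc n) * Q n x"
  by simp

lemma R_Q_even: "R n (- x) = R n x \<and> Q n (- x) = Q n x"
  by (induction n) auto

text \<open>
  \<open>L b\<close> is the difference operator of the Wilson polynomials in the variable \<open>x\<^sup>2\<close>, with the
  parameter \<open>b\<close> singled out because both \<open>b\<close> and \<open>b + 1\<close> occur; \<open>weight\<close> carries the three
  other parameters.
\<close>
definition L :: "complex \<Rightarrow> (complex \<Rightarrow> complex) \<Rightarrow> complex \<Rightarrow> complex" where
  "L \<beta> f x = (x + \<beta>) * weight x * (f (x + 1) - f x) + (\<beta> - x) * weight (- x) * (f (x - 1) - f x)"

definition E :: "(complex \<Rightarrow> complex) \<Rightarrow> complex \<Rightarrow> complex" where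
  "E f x = weight x * (f (x + 1) - f x) + weight (- x) * (f (x - 1) - f x)"

text \<open>
  The defect in intertwining \<open>L (b + 1)\<close> with \<open>L b\<close> through multiplication by \<open>x\<^sup>2 - b\<^sup>2\<close>.
  The coefficients of \<open>f (x \<plusminus> 1)\<close> lose one degree by cancellation, which is why \<open>F\<close> can be
  compared with \<open>E\<close>.
\<close>
definition F :: "(complex \<Rightarrow> complex) \<Rightarrow> complex \<Rightarrow> complex" where
  "F f x = L b (\<lambda>t. (t\<^sup>2 - b\<^sup>2) * f t) x - (x\<^sup>2 - b\<^sup>2) * L (b + 1) f x"

lemma L_add_one: "L (\<beta> + 1) f x = L \<beta> f x + E f x"
  by (simp add: L_def E_def algebra_simps)

text \<open>
  The product \<open>2 x (1 + 2 x) weight x\<close> is the cubic \<open>(x + a) (x + c) (x + d)\<close>; its odd and even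
  parts are \<open>x\<close> times the first and the second right-hand side itself.
\<close>
lemma weight_sum:
  assumes "x \<notin> {0, 1/2, -1/2}"
  shows "(1 + 2 * x) * weight x + (1 - 2 * x) * weight (- x) = x\<^sup>2 + (a * c + a * d + c * d)"
    and "x * ((1 + 2 * x) * weight x - (1 - 2 * x) * weight (- x)) = (a + c + d) * x\<^sup>2 + a * c * d"
proof -
  have nz: "x \<noteq> 0" "1 + 2 * x \<noteq> 0" "1 - 2 * x \<noteq> 0"
    using assms by (auto simp: field_simps add_eq_0_iff)
  have p: "(1 + 2 * x) * weight x = (x + a) * (x + c) * (x + d) / (2 * x)"
    using nz by (simp add: weight_def divide_simps add.commute)
  have m: "(1 - 2 * x) * weight (- x) = - ((a - x) * (c - x) * (d - x) / (2 * x))"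
    using nz by (simp add: weight_def divide_simps add.commute)
  show "(1 + 2 * x) * weight x + (1 - 2 * x) * weight (- x) = x\<^sup>2 + (a * c + a * d + c * d)"
    unfolding p m using nz by (simp add: field_simps power2_eq_square)
  show "x * ((1 + 2 * x) * weight x - (1 - 2 * x) * weight (- x)) = (a + c + d) * x\<^sup>2 + a * c * d"
    unfolding p m using nz by (simp add: field_simps power2_eq_square)
qed

lemma weight_sum_shifted:
  assumes "x \<notin> {0, 1/2, -1/2}"
  shows "(x + \<beta>) * (1 + 2 * x) * weight x + (\<beta> - x) * (1 - 2 * x) * weight (- x)
    = (a + c + d + \<beta>) * x\<^sup>2 + (a * c * d + \<beta> * (a * c + a * d + c * d))"
  using weight_sum[OF assms] by algebra

text \<open>
  On both sides the coefficients of \<open>f (x \<plusminus> 1)\<close> agree, since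
  \<open>(x - b) + (2 b + 1) = x + b + 1\<close>. What remains is a multiple of \<open>f x\<close>, and its factor is the
  sum evaluated in \<open>weight_sum_shifted\<close>.
\<close>
lemma F_eq:
  assumes "x \<notin> {0, 1/2, -1/2}"
  shows "F f x = (x\<^sup>2 - b\<^sup>2) * E f x + (2 * b + 1) * L b f x
    + (s * x\<^sup>2 + a * c * d + b * (a * c + a * d + c * d)) * f x"
  using weight_sum_shifted[OF assms, of b] unfolding F_def E_def L_def by algebra

text \<open>
  The mirror image of \<open>F_eq\<close>, with \<open>E\<close> now applied after the multiplication. The relation
  \<open>(x + 1 - b) = (x + b) - (2 b - 1)\<close> matches the coefficients of \<open>f (x + 1)\<close>, and the multiple of
  \<open>f x\<close> that remains is the same sum for \<open>b - 1\<close> in place of \<open>b\<close>.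
\<close>
lemma E_mult_eq:
  assumes "x \<notin> {0, 1/2, -1/2}"
  shows "E (\<lambda>t. (t\<^sup>2 - b\<^sup>2) * f t) x = F f x - (2 * b - 1) * L (b + 1) f x
    - ((s - 1) * x\<^sup>2 + a * c * d + (b - 1) * (a * c + a * d + c * d)) * f x"
  using weight_sum_shifted[OF assms, of "b - 1"] unfolding F_def E_def L_def by algebra

lemma denom_nz: "2 * of_nat n + s \<noteq> 0" "2 * of_nat n + s - 1 \<noteq> 0" "2 * of_nat n + s + 1 \<noteq> 0"
  using denom[of "2 * n + 1"] denom[of "2 * n"] denom[of "2 * n + 2"] by (simp_all add: algebra_simps)

text \<open>
  The next two identities are the comparison of coefficients in the induction below:
  each determines the next \<open>\<tau>\<close> from the previous one. In both summands on the left the linear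
  factor cancels one of the two denominators, and the other one is common to them; clearing
  it leaves a polynomial identity.
\<close>
lemma tau_odd_step:
  "(2 * of_nat n + s) * \<tau>_odd n - (2 * of_nat n + s - 2) * \<tau>_even n
   = - (s * b\<^sup>2) - (a * c * d + b * (a * c + a * d + c * d))
     - (2 * b + 1) * (of_nat n * (of_nat n + s - 1))"
proof -
  define N :: complex where "N = of_nat n"
  have nz: "2 * N + s \<noteq> 0" "2 * N + s - 1 \<noteq> 0"
    using denom_nz[of n] by (simp_all add: N_def)
  have o: "(2 * N + s) * \<tau>_odd n
      = - ((N + s - 1) * (N + a + b) * (N + b + c) * (N + b + d)) / (2 * N + s - 1)"
    using nz by (simp add: \<tau>_odd_def N_def[symmetric])
  \<comment> \<open>\<open>2 N + s - 2\<close> can vanish only for \<open>n = 0\<close>, where \<open>N\<close> makes both sides zero.\<close>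
  have e: "(2 * N + s - 2) * \<tau>_even n
      = - (N * (N + a + c - 1) * (N + a + d - 1) * (N + c + d - 1)) / (2 * N + s - 1)"
  proof (cases "2 * N + s - 2 = 0")
    case True
    show ?thesis
    proof (cases n)
      case (Suc m)
      then show ?thesis using True denom_nz(1)[of m] by (simp add: N_def algebra_simps)
    qed (simp add: \<tau>_even_def N_def)
  qed (use nz in \<open>simp add: \<tau>_even_def N_def[symmetric]\<close>)
  have "(2 * N + s) * \<tau>_odd n - (2 * N + s - 2) * \<tau>_even n
    = (- ((N + s - 1) * (N + a + b) * (N + b + c) * (N + b + d))
       + N * (N + a + c - 1) * (N + a + d - 1) * (N + c + d - 1)) / (2 * N + s - 1)"
    unfolding o e by (simp add: diff_divide_distrib add_divide_distrib)
  also have "\<dots> = - (s * b\<^sup>2) - (a * c * d + b * (a * c + a * d + c * d))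
     - (2 * b + 1) * (N * (N + s - 1))"
    unfolding divide_eq_eq using nz(2) by simp algebra
  finally show ?thesis by (simp add: N_def)
qed

lemma tau_even_step:
  "(2 * of_nat n + s + 1) * \<tau>_even (Suc n) - (2 * of_nat n + s - 1) * \<tau>_odd n
   = (2 * b - 1) * (of_nat n * (of_nat n + s)) + (s - 1) * b\<^sup>2
     + (a * c * d + (b - 1) * (a * c + a * d + c * d))"
proof -
  define N :: complex where "N = of_nat n"
  have nz: "2 * N + s \<noteq> 0" "2 * N + s - 1 \<noteq> 0" "2 * N + s + 1 \<noteq> 0"
    using denom_nz[of n] by (simp_all add: N_def)
  have o: "(2 * N + s - 1) * \<tau>_odd n
      = - ((N + s - 1) * (N + a + b) * (N + b + c) * (N + b + d)) / (2 * N + s)"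
    using nz by (simp add: \<tau>_odd_def N_def[symmetric])
  have "\<tau>_even (Suc n) = - ((N + 1) * (N + a + c) * (N + a + d) * (N + c + d)
     / ((2 * N + s + 1) * (2 * N + s)))"
    by (simp add: \<tau>_even_def N_def algebra_simps)
  then have e: "(2 * N + s + 1) * \<tau>_even (Suc n)
      = - ((N + 1) * (N + a + c) * (N + a + d) * (N + c + d)) / (2 * N + s)"
    using nz by simp
  have "(2 * N + s + 1) * \<tau>_even (Suc n) - (2 * N + s - 1) * \<tau>_odd n
    = (- ((N + 1) * (N + a + c) * (N + a + d) * (N + c + d))
       + (N + s - 1) * (N + a + b) * (N + b + c) * (N + b + d)) / (2 * N + s)"
    unfolding o e by (simp add: diff_divide_distrib add_divide_distrib)
  also have "\<dots> = (2 * b - 1) * (N * (N + s)) + (s - 1) * b\<^sup>2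
     + (a * c * d + (b - 1) * (a * c + a * d + c * d))"
    unfolding divide_eq_eq using nz(1) by simp algebra
  finally show ?thesis by (simp add: N_def)
qed

lemma E_linear: "E (\<lambda>t. u * f t - v * h t) x = u * E f x - v * E h x"
  by (simp add: E_def algebra_simps)

lemma L_linear: "L \<beta> (\<lambda>t. u * f t - v * h t) x = u * L \<beta> f x - v * L \<beta> h x"
  by (simp add: L_def algebra_simps)

lemma F_linear: "F (\<lambda>t. u * f t - v * h t) x = u * F f x - v * F h x"
  by (simp add: F_def L_def algebra_simps)

section \<open>The joint induction\<close>

text \<open>
  Applying \<open>L b\<close> and \<open>E\<close> to \<open>R\<^sub>n\<^sub>+\<^sub>1 = (x\<^sup>2 - b\<^sup>2) Q\<^sub>n - \<tau>\<^sub>2\<^sub>n\<^sub>+\<^sub>1 R\<^sub>n\<close> leads back to \<open>F Q\<^sub>n\<close>,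
  \<open>L (b + 1) Q\<^sub>n\<close>, \<open>L b R\<^sub>n\<close> and \<open>E R\<^sub>n\<close>: the first by the definition of \<open>F\<close>, the second by
  \<open>E_mult_eq\<close>. In the second, comparing the coefficients of \<open>Q\<^sub>n\<close> gives \<open>tau_even_step\<close>.
\<close>
lemma L_E_R_Suc:
  assumes x: "x \<notin> {0, 1/2, -1/2}"
    and LR: "L b (R n) x = of_nat n * (of_nat n + s - 1) * R n x"
    and ER: "E (R n) x = (2 * of_nat n + s - 1) * Q n x - (of_nat n + s - 1) * R n x"
    and LQ: "L (b + 1) (Q n) x = of_nat n * (of_nat n + s) * Q n x"
    and FQ: "F (Q n) x = (2 * of_nat n + s) * R (Suc n) x - of_nat n * (x\<^sup>2 - b\<^sup>2) * Q n x"
  shows "L b (R (Suc n)) x = of_nat (Suc n) * (of_nat (Suc n) + s - 1) * R (Suc n) x"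
    and "E (R (Suc n)) x = (2 * of_nat (Suc n) + s - 1) * Q (Suc n) x
           - (of_nat (Suc n) + s - 1) * R (Suc n) x"
proof -
  have fn: "R (Suc n) = (\<lambda>t. 1 * ((t\<^sup>2 - b\<^sup>2) * Q n t) - \<tau>_odd n * R n t)"
    by (simp add: fun_eq_iff)
  have val: "R (Suc n) x = (x\<^sup>2 - b\<^sup>2) * Q n x - \<tau>_odd n * R n x"
    by simp
  have "L b (R (Suc n)) x = F (Q n) x + (x\<^sup>2 - b\<^sup>2) * L (b + 1) (Q n) x - \<tau>_odd n * L b (R n) x"
    unfolding fn L_linear F_def by simp
  then show "L b (R (Suc n)) x = of_nat (Suc n) * (of_nat (Suc n) + s - 1) * R (Suc n) x"
    unfolding FQ LQ LR val of_nat_Suc by algebra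
  have "E (R (Suc n)) x = F (Q n) x - (2 * b - 1) * L (b + 1) (Q n) x
      - ((s - 1) * x\<^sup>2 + a * c * d + (b - 1) * (a * c + a * d + c * d)) * Q n x
      - \<tau>_odd n * E (R n) x"
    unfolding fn E_linear E_mult_eq[OF x] by simp
  then show "E (R (Suc n)) x = (2 * of_nat (Suc n) + s - 1) * Q (Suc n) x
           - (of_nat (Suc n) + s - 1) * R (Suc n) x"
    unfolding FQ LQ ER Q_Suc val of_nat_Suc using tau_even_step[of n] by algebra
qed

text \<open>
  The same for \<open>Q\<^sub>n\<^sub>+\<^sub>1 = R\<^sub>n\<^sub>+\<^sub>1 - \<tau>\<^sub>2\<^sub>n\<^sub>+\<^sub>2 Q\<^sub>n\<close>: \<open>L (b + 1)\<close> is \<open>L b + E\<close> on the first summand, and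
  \<open>F\<close> is reduced to \<open>E\<close> and \<open>L b\<close> there by \<open>F_eq\<close>. Comparing the coefficients of \<open>R\<^sub>n\<^sub>+\<^sub>1\<close> gives
  \<open>tau_odd_step\<close> at \<open>n + 1\<close>.
\<close>
lemma L_F_Q_Suc:
  assumes x: "x \<notin> {0, 1/2, -1/2}"
    and LR: "L b (R (Suc n)) x = of_nat (Suc n) * (of_nat (Suc n) + s - 1) * R (Suc n) x"
    and ER: "E (R (Suc n)) x = (2 * of_nat (Suc n) + s - 1) * Q (Suc n) x
           - (of_nat (Suc n) + s - 1) * R (Suc n) x"
    and LQ: "L (b + 1) (Q n) x = of_nat n * (of_nat n + s) * Q n x"
    and FQ: "F (Q n) x = (2 * of_nat n + s) * R (Suc n) x - of_nat n * (x\<^sup>2 - b\<^sup>2) * Q n x"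
  shows "L (b + 1) (Q (Suc n)) x = of_nat (Suc n) * (of_nat (Suc n) + s) * Q (Suc n) x"
    and "F (Q (Suc n)) x = (2 * of_nat (Suc n) + s) * R (Suc (Suc n)) x
           - of_nat (Suc n) * (x\<^sup>2 - b\<^sup>2) * Q (Suc n) x"
proof -
  have fn: "Q (Suc n) = (\<lambda>t. 1 * R (Suc n) t - \<tau>_even (Suc n) * Q n t)"
    by (simp add: fun_eq_iff)
  have val: "R (Suc n) x = Q (Suc n) x + \<tau>_even (Suc n) * Q n x"
    by simp
  have "L (b + 1) (Q (Suc n)) x
      = L b (R (Suc n)) x + E (R (Suc n)) x - \<tau>_even (Suc n) * L (b + 1) (Q n) x"
    unfolding fn L_linear L_add_one by simp
  then show "L (b + 1) (Q (Suc n)) x = of_nat (Suc n) * (of_nat (Suc n) + s) * Q (Suc n) x"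
    unfolding LR ER LQ val of_nat_Suc by algebra
  have val2: "R (Suc (Suc n)) x = (x\<^sup>2 - b\<^sup>2) * Q (Suc n) x - \<tau>_odd (Suc n) * R (Suc n) x"
    by simp
  have "F (Q (Suc n)) x = (x\<^sup>2 - b\<^sup>2) * E (R (Suc n)) x + (2 * b + 1) * L b (R (Suc n)) x
    + (s * x\<^sup>2 + a * c * d + b * (a * c + a * d + c * d)) * R (Suc n) x
    - \<tau>_even (Suc n) * F (Q n) x"
    unfolding fn F_linear F_eq[OF x, of "R (Suc n)"] by simp
  then show "F (Q (Suc n)) x = (2 * of_nat (Suc n) + s) * R (Suc (Suc n)) x
           - of_nat (Suc n) * (x\<^sup>2 - b\<^sup>2) * Q (Suc n) x"
    unfolding LR ER FQ val2 val of_nat_Suc using tau_odd_step[of "Suc n"]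
    unfolding of_nat_Suc by algebra
qed

theorem wilson_eigen:
  assumes x: "x \<notin> {0, 1/2, -1/2}"
  shows "L b (R n) x = of_nat n * (of_nat n + s - 1) * R n x"
    and "L (b + 1) (Q n) x = of_nat n * (of_nat n + s) * Q n x"
proof -
  have "L b (R n) x = of_nat n * (of_nat n + s - 1) * R n x
    \<and> E (R n) x = (2 * of_nat n + s - 1) * Q n x - (of_nat n + s - 1) * R n x
    \<and> L (b + 1) (Q n) x = of_nat n * (of_nat n + s) * Q n x
    \<and> F (Q n) x = (2 * of_nat n + s) * R (Suc n) x - of_nat n * (x\<^sup>2 - b\<^sup>2) * Q n x"
  proof (induction n)
    case 0
    \<comment> \<open>On constants only the relation for \<open>F\<close> has content: it says \<open>F 1 = s R\<^sub>1\<close>,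
      which determines \<open>\<tau>\<^sub>1\<close>.\<close>
    have "F (Q 0) x = s * x\<^sup>2 + a * c * d + b * (a * c + a * d + c * d)"
      using F_eq[OF x, of "Q 0"] by (simp add: E_def L_def)
    moreover have "s * \<tau>_odd 0 = - (s * b\<^sup>2) - (a * c * d + b * (a * c + a * d + c * d))"
      using tau_odd_step[of 0] by (simp add: \<tau>_even_def)
    ultimately have "F (Q 0) x = s * (x\<^sup>2 - b\<^sup>2 - \<tau>_odd 0)"
      by algebra
    moreover have "L b (R 0) x = 0" "L (b + 1) (Q 0) x = 0" "E (R 0) x = 0"
      by (simp_all add: L_def E_def)
    moreover have "R (Suc 0) x = x\<^sup>2 - b\<^sup>2 - \<tau>_odd 0" "R 0 x = 1" "Q 0 x = 1"
      by simp_all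
    ultimately show ?case
      by (simp del: R.simps Q.simps)
  next
    case (Suc n)
    then show ?case using L_E_R_Suc[OF x] L_F_Q_Suc[OF x] by blast
  qed
  then show "L b (R n) x = of_nat n * (of_nat n + s - 1) * R n x"
    and "L (b + 1) (Q n) x = of_nat n * (of_nat n + s) * Q n x"
    by auto
qed

end

section \<open>The recurrence of the complementary Bannai--Ito polynomials\<close>

text \<open>
  Inserting the recurrence of \<open>B\<^sub>n\<close> into the definition of \<open>I\<^sub>n\<close> gives
  \<open>(x - \<rho>\<^sub>1) I\<^sub>n = (x - \<rho>\<^sub>1) (B\<^sub>n + C\<^sub>n I\<^sub>n\<^sub>-\<^sub>1)\<close>. This inverts the transformation from \<open>B\<^sub>n\<close> to
  \<open>I\<^sub>n\<close>, and inserting it back into the definition of \<open>I\<^sub>n\<close> yields the three-term recurrence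
  \<open>CBI_poly_rec\<close>.
\<close>
lemma BI_poly_eq_CBI_poly:
  "BI_poly \<rho>1 \<rho>2 r1 r2 (Suc n)
     = CBI_poly \<rho>1 \<rho>2 r1 r2 (Suc n) - smult (BI_C \<rho>1 \<rho>2 r1 r2 (Suc n)) (CBI_poly \<rho>1 \<rho>2 r1 r2 n)"
    (is "?B (Suc n) = ?I (Suc n) - smult ?C (?I n)")
proof -
  have "[:- \<rho>1, 1:] * (?I (Suc n) - smult ?C (?I n)) = [:- \<rho>1, 1:] * ?B (Suc n)"
    unfolding right_diff_distrib mult_smult_right CBI_poly_times
    by (simp add: algebra_simps smult_add_left smult_diff_left smult_diff_right smult_add_right)
  then show ?thesis
    by (metis mult_left_cancel pCons_eq_0_iff zero_neq_one)
qed

lemma CBI_poly_0: "CBI_poly \<rho>1 \<rho>2 r1 r2 0 = 1"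
proof -
  have "[:- \<rho>1, 1:] * CBI_poly \<rho>1 \<rho>2 r1 r2 0 = [:- \<rho>1, 1:] * 1"
    unfolding CBI_poly_times by (simp add: BI_C_def one_pCons)
  then show ?thesis
    by (metis mult_left_cancel pCons_eq_0_iff zero_neq_one)
qed

lemma CBI_poly_1:
  "poly (CBI_poly \<rho>1 \<rho>2 r1 r2 (Suc 0)) x
     = x - (\<rho>1 - BI_A \<rho>1 \<rho>2 r1 r2 0 - BI_C \<rho>1 \<rho>2 r1 r2 (Suc 0))"
  using arg_cong[OF BI_poly_eq_CBI_poly[of \<rho>1 \<rho>2 r1 r2 0], of "\<lambda>p. poly p x"]
  by (simp add: CBI_poly_0 BI_C_def algebra_simps)

lemma CBI_poly_rec:
  "poly (CBI_poly \<rho>1 \<rho>2 r1 r2 (Suc (Suc n))) x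
     = (x - (\<rho>1 - BI_A \<rho>1 \<rho>2 r1 r2 (Suc n) - BI_C \<rho>1 \<rho>2 r1 r2 (Suc (Suc n))))
         * poly (CBI_poly \<rho>1 \<rho>2 r1 r2 (Suc n)) x
       - BI_A \<rho>1 \<rho>2 r1 r2 (Suc n) * BI_C \<rho>1 \<rho>2 r1 r2 (Suc n) * poly (CBI_poly \<rho>1 \<rho>2 r1 r2 n) x"
  using arg_cong[OF CBI_poly_times[of \<rho>1 \<rho>2 r1 r2 "Suc n"], of "\<lambda>p. poly p x"]
  unfolding BI_poly_eq_CBI_poly by (simp add: algebra_simps)

section \<open>Reduction of the Dunkl operator to the Wilson operators\<close>

context
  fixes \<rho>1 \<rho>2 r1 r2 :: complex
  assumes adm: "BI_admissible \<rho>1 \<rho>2 r1 r2"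
begin

interpretation W: wilson "\<rho>1 + 1" \<rho>2 "1/2 - r1" "1/2 - r2"
proof
  fix n :: nat
  have "of_nat n + BI_g \<rho>1 \<rho>2 r1 r2 + 1 \<noteq> 0"
    using adm by (simp add: BI_admissible_def)
  then show "of_nat n + (\<rho>1 + 1 + \<rho>2 + (1/2 - r1) + (1/2 - r2)) - 1 \<noteq> 0"
    by (simp add: BI_g_def algebra_simps)
qed

text \<open>
  Both terms have the same denominator, and it divides the sum of the numerators; this is what
  makes the diagonal recurrence coefficients of \<open>I\<^sub>n\<close> as simple as \<open>\<plusminus> \<rho>\<^sub>2\<close>.
\<close>
lemma BI_A_C_Suc:
  "\<rho>1 - BI_A \<rho>1 \<rho>2 r1 r2 n - BI_C \<rho>1 \<rho>2 r1 r2 (Suc n) = (if even n then \<rho>2 else - \<rho>2)"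
proof -
  define N :: complex where "N = of_nat n"
  define D where "D = 4 * (N + BI_g \<rho>1 \<rho>2 r1 r2 + 1)"
  have nz: "D \<noteq> 0"
    using adm unfolding BI_admissible_def D_def N_def by (metis mult_eq_0_iff zero_neq_numeral)
  have D': "4 * (1 + N + BI_g \<rho>1 \<rho>2 r1 r2) = D"
    by (simp add: D_def)
  show ?thesis
  proof (cases "even n")
    case True
    have "BI_A \<rho>1 \<rho>2 r1 r2 n = (N + 2 * \<rho>1 - 2 * r1 + 1) * (N + 2 * \<rho>1 - 2 * r2 + 1) / D"
      using True by (simp add: BI_A_def D_def N_def Let_def)
    moreover have "BI_C \<rho>1 \<rho>2 r1 r2 (Suc n) = - ((1 + N + 2 * \<rho>2 - 2 * r2) * (1 + N + 2 * \<rho>2 - 2 * r1) / D)"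
      using True unfolding D'[symmetric] by (simp add: BI_C_def N_def Let_def)
    ultimately have "\<rho>1 - BI_A \<rho>1 \<rho>2 r1 r2 n - BI_C \<rho>1 \<rho>2 r1 r2 (Suc n)
      = \<rho>1 - ((N + 2 * \<rho>1 - 2 * r1 + 1) * (N + 2 * \<rho>1 - 2 * r2 + 1)
          - (1 + N + 2 * \<rho>2 - 2 * r2) * (1 + N + 2 * \<rho>2 - 2 * r1)) / D"
      by (simp add: diff_divide_distrib)
    also have "(N + 2 * \<rho>1 - 2 * r1 + 1) * (N + 2 * \<rho>1 - 2 * r2 + 1)
          - (1 + N + 2 * \<rho>2 - 2 * r2) * (1 + N + 2 * \<rho>2 - 2 * r1) = (\<rho>1 - \<rho>2) * D"
      unfolding D_def BI_g_def by algebra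
    finally show ?thesis using True nz by simp
  next
    case False
    have "BI_A \<rho>1 \<rho>2 r1 r2 n = (N + 2 * BI_g \<rho>1 \<rho>2 r1 r2 + 1) * (N + 2 * \<rho>1 + 2 * \<rho>2 + 1) / D"
      using False by (simp add: BI_A_def D_def N_def Let_def)
    moreover have "BI_C \<rho>1 \<rho>2 r1 r2 (Suc n) = - ((1 + N) * (1 + N - 2 * r1 - 2 * r2) / D)"
      using False unfolding D'[symmetric] by (simp add: BI_C_def N_def Let_def)
    ultimately have "\<rho>1 - BI_A \<rho>1 \<rho>2 r1 r2 n - BI_C \<rho>1 \<rho>2 r1 r2 (Suc n)
      = \<rho>1 - ((N + 2 * BI_g \<rho>1 \<rho>2 r1 r2 + 1) * (N + 2 * \<rho>1 + 2 * \<rho>2 + 1)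
          - (1 + N) * (1 + N - 2 * r1 - 2 * r2)) / D"
      by (simp add: diff_divide_distrib)
    also have "(N + 2 * BI_g \<rho>1 \<rho>2 r1 r2 + 1) * (N + 2 * \<rho>1 + 2 * \<rho>2 + 1)
          - (1 + N) * (1 + N - 2 * r1 - 2 * r2) = (\<rho>1 + \<rho>2) * D"
      unfolding D_def BI_g_def by algebra
    finally show ?thesis using False nz by simp
  qed
qed

lemma BI_A_mult_BI_C:
  "BI_A \<rho>1 \<rho>2 r1 r2 (2 * n) * BI_C \<rho>1 \<rho>2 r1 r2 (2 * n) = W.\<tau>_even n"
  "BI_A \<rho>1 \<rho>2 r1 r2 (Suc (2 * n)) * BI_C \<rho>1 \<rho>2 r1 r2 (Suc (2 * n)) = W.\<tau>_odd n"
proof -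
  define N :: complex where "N = of_nat n"
  have quot: "X / (4 * u) * - (Y / (4 * v)) = - (Z / (u * v))" if "X * Y = 16 * Z"
    for X Y Z u v :: complex
    using that by simp
  have "BI_C \<rho>1 \<rho>2 r1 r2 (2 * n)
      = - (2 * N * (2 * N - 2 * r1 - 2 * r2) / (4 * (2 * N + BI_g \<rho>1 \<rho>2 r1 r2)))"
    by (cases "n = 0") (simp_all add: BI_C_def N_def Let_def)
  then have "BI_A \<rho>1 \<rho>2 r1 r2 (2 * n) * BI_C \<rho>1 \<rho>2 r1 r2 (2 * n)
    = (2 * N + 2 * \<rho>1 - 2 * r1 + 1) * (2 * N + 2 * \<rho>1 - 2 * r2 + 1)
        / (4 * (2 * N + BI_g \<rho>1 \<rho>2 r1 r2 + 1))
      * - (2 * N * (2 * N - 2 * r1 - 2 * r2) / (4 * (2 * N + BI_g \<rho>1 \<rho>2 r1 r2)))"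
    by (simp add: BI_A_def N_def Let_def)
  also have "\<dots> = - (N * (N + (\<rho>1 + 1) + (1/2 - r1) - 1) * (N + (\<rho>1 + 1) + (1/2 - r2) - 1)
        * (N + (1/2 - r1) + (1/2 - r2) - 1)
      / ((2 * N + BI_g \<rho>1 \<rho>2 r1 r2 + 1) * (2 * N + BI_g \<rho>1 \<rho>2 r1 r2)))"
    by (rule quot) (simp add: field_simps)
  also have "2 * N + BI_g \<rho>1 \<rho>2 r1 r2 + 1 = 2 * N + W.s - 1"
    by (simp add: BI_g_def)
  also have "2 * N + BI_g \<rho>1 \<rho>2 r1 r2 = 2 * N + W.s - 2"
    by (simp add: BI_g_def)
  finally show "BI_A \<rho>1 \<rho>2 r1 r2 (2 * n) * BI_C \<rho>1 \<rho>2 r1 r2 (2 * n) = W.\<tau>_even n"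
    by (simp only: W.\<tau>_even_def N_def)
  have "BI_A \<rho>1 \<rho>2 r1 r2 (Suc (2 * n)) * BI_C \<rho>1 \<rho>2 r1 r2 (Suc (2 * n))
    = (1 + 2 * N + 2 * BI_g \<rho>1 \<rho>2 r1 r2 + 1) * (1 + 2 * N + 2 * \<rho>1 + 2 * \<rho>2 + 1)
        / (4 * (1 + 2 * N + BI_g \<rho>1 \<rho>2 r1 r2 + 1))
      * - ((1 + 2 * N + 2 * \<rho>2 - 2 * r2) * (1 + 2 * N + 2 * \<rho>2 - 2 * r1)
        / (4 * (1 + 2 * N + BI_g \<rho>1 \<rho>2 r1 r2)))"
    by (simp add: BI_A_def BI_C_def N_def Let_def)
  also have "\<dots> = - ((N + W.s - 1) * (N + (\<rho>1 + 1) + \<rho>2) * (N + \<rho>2 + (1/2 - r1))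
        * (N + \<rho>2 + (1/2 - r2))
      / ((1 + 2 * N + BI_g \<rho>1 \<rho>2 r1 r2 + 1) * (1 + 2 * N + BI_g \<rho>1 \<rho>2 r1 r2)))"
    by (rule quot) (simp add: BI_g_def field_simps)
  also have "1 + 2 * N + BI_g \<rho>1 \<rho>2 r1 r2 + 1 = 2 * N + W.s"
    by (simp add: BI_g_def)
  also have "1 + 2 * N + BI_g \<rho>1 \<rho>2 r1 r2 = 2 * N + W.s - 1"
    by (simp add: BI_g_def)
  finally show "BI_A \<rho>1 \<rho>2 r1 r2 (Suc (2 * n)) * BI_C \<rho>1 \<rho>2 r1 r2 (Suc (2 * n)) = W.\<tau>_odd n"
    by (simp only: W.\<tau>_odd_def N_def)
qed

text \<open>
  Since the diagonal coefficients alternate in sign, two steps of the recurrence multiply by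
  \<open>(x - \<rho>\<^sub>2) (x + \<rho>\<^sub>2)\<close>, which is even; so up to the factor \<open>x - \<rho>\<^sub>2\<close> parity is preserved.
\<close>
lemma CBI_poly_eq_wilson:
  "poly (CBI_poly \<rho>1 \<rho>2 r1 r2 (2 * n)) x = W.R n x
   \<and> poly (CBI_poly \<rho>1 \<rho>2 r1 r2 (Suc (2 * n))) x = (x - \<rho>2) * W.Q n x"
proof (induction n)
  case 0
  then show ?case using BI_A_C_Suc[of 0] by (simp add: CBI_poly_0 CBI_poly_1)
next
  case (Suc n)
  have "poly (CBI_poly \<rho>1 \<rho>2 r1 r2 (2 * Suc n)) x
      = (x + \<rho>2) * ((x - \<rho>2) * W.Q n x) - W.\<tau>_odd n * W.R n x"
    using CBI_poly_rec[of \<rho>1 \<rho>2 r1 r2 "2 * n" x] Suc BI_A_C_Suc[of "Suc (2 * n)"] BI_A_mult_BI_C(2)[of n]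
    by (simp del: W.R.simps W.Q.simps)
  then have R: "poly (CBI_poly \<rho>1 \<rho>2 r1 r2 (2 * Suc n)) x = W.R (Suc n) x"
    unfolding W.R.simps by algebra
  have "poly (CBI_poly \<rho>1 \<rho>2 r1 r2 (Suc (2 * Suc n))) x
      = (x - \<rho>2) * W.R (Suc n) x - W.\<tau>_even (Suc n) * ((x - \<rho>2) * W.Q n x)"
    using CBI_poly_rec[of \<rho>1 \<rho>2 r1 r2 "Suc (2 * n)" x] Suc BI_A_C_Suc[of "2 * Suc n"]
      BI_A_mult_BI_C(1)[of "Suc n"] R
    by (simp del: W.R.simps W.Q.simps)
  then have "poly (CBI_poly \<rho>1 \<rho>2 r1 r2 (Suc (2 * Suc n))) x = (x - \<rho>2) * W.Q (Suc n) x"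
    unfolding W.Q_Suc by (simp only: algebra_simps)
  with R show ?case by blast
qed

text \<open>
  All four coefficients are multiples of \<open>weight x\<close> and \<open>weight (- x)\<close>. For \<open>C(x)\<close> this depends on the
  value of \<open>\<omega>\<close>: it is \<open>4 (a c + a d + c d)\<close>, so that \<open>4 x\<^sup>2 + \<omega>\<close> is four times the first sum in
  \<open>weight_sum\<close>.
\<close>
lemma coeffs_eq_weight:
  assumes "x \<notin> dunkl_poles"
  shows "(x + 1) * coeff_A \<rho>1 \<rho>2 r1 r2 x = x * (x + \<rho>2 + 1) * W.weight x"
    and "coeff_B \<rho>1 \<rho>2 r1 r2 x = (\<rho>2 - x) * W.weight (- x)"
    and "2 * x * coeff_C \<rho>1 \<rho>2 r1 r2 x = (x - \<rho>2) * (W.weight x + W.weight (- x))"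
    and "(x + 1) * coeff_D \<rho>1 \<rho>2 r1 r2 x = \<rho>2 * W.weight x"
proof -
  have nz: "x \<noteq> 0" "x + 1 \<noteq> 0" "2 * x + 1 \<noteq> 0" "2 * x - 1 \<noteq> 0"
    using assms by (auto simp: dunkl_poles_def field_simps add_eq_0_iff)
  define P where "P = (x + \<rho>1 + 1) * (2 * x - 2 * r1 + 1) * (2 * x - 2 * r2 + 1)"
  define M where "M = (x - \<rho>1 - 1) * (2 * x + 2 * r1 - 1) * (2 * x + 2 * r2 - 1)"
  have w: "W.weight x = P / (8 * x * (2 * x + 1))"
    using nz unfolding W.weight_def P_def by (simp add: divide_simps) algebra
  have m: "W.weight (- x) = - M / (8 * x * (2 * x - 1))"
  proof -
    have "(- x + (\<rho>1 + 1)) * (- x + (1/2 - r1)) * (- x + (1/2 - r2)) = - M / 4"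
      unfolding M_def by (simp add: field_simps)
    moreover have "2 * - x * (2 * - x + 1) = 2 * x * (2 * x - 1)"
      by algebra
    ultimately have "W.weight (- x) = (- M / 4) / (2 * x * (2 * x - 1))"
      by (simp only: W.weight_def)
    then show ?thesis
      by simp
  qed
  have cancel: "k * (X / (j * k * m)) = X / (j * m)" if "k \<noteq> 0" for j k m X :: complex
    using that by simp
  have "coeff_A \<rho>1 \<rho>2 r1 r2 x = (x + \<rho>2 + 1) * P / (8 * (x + 1) * (2 * x + 1))"
    by (simp add: coeff_A_def P_def mult_ac)
  then show "(x + 1) * coeff_A \<rho>1 \<rho>2 r1 r2 x = x * (x + \<rho>2 + 1) * W.weight x"
    using nz(1) by (simp only: cancel[OF nz(2)] w) simp
  have "coeff_B \<rho>1 \<rho>2 r1 r2 x = (x - \<rho>2) * M / (8 * x * (2 * x - 1))"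
    by (simp add: coeff_B_def M_def mult_ac)
  also have "\<dots> = (\<rho>2 - x) * W.weight (- x)"
    unfolding m times_divide_eq_right by algebra
  finally show B: "coeff_B \<rho>1 \<rho>2 r1 r2 x = (\<rho>2 - x) * W.weight (- x)" .
  have "coeff_D \<rho>1 \<rho>2 r1 r2 x = \<rho>2 * P / (8 * x * (x + 1) * (2 * x + 1))"
    by (simp add: coeff_D_def P_def mult_ac)
  then show "(x + 1) * coeff_D \<rho>1 \<rho>2 r1 r2 x = \<rho>2 * W.weight x"
    using nz(1) by (simp only: cancel[OF nz(2)] w) simp
  have "coeff_C \<rho>1 \<rho>2 r1 r2 x = (x - \<rho>2) * (4 * x\<^sup>2 + CBI_omega \<rho>1 r1 r2) / (8 * x)
      - (x - \<rho>2) * P / (8 * x * (2 * x + 1)) - coeff_B \<rho>1 \<rho>2 r1 r2 x"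
    by (simp add: coeff_C_def P_def mult_ac)
  also have "\<dots> = (x - \<rho>2) * (4 * x\<^sup>2 + CBI_omega \<rho>1 r1 r2) / (8 * x)
      - (x - \<rho>2) * W.weight x - (\<rho>2 - x) * W.weight (- x)"
    unfolding B w by simp
  finally have C: "8 * x * coeff_C \<rho>1 \<rho>2 r1 r2 x = (x - \<rho>2) * (4 * x\<^sup>2 + CBI_omega \<rho>1 r1 r2)
      - 8 * x * ((x - \<rho>2) * W.weight x) - 8 * x * ((\<rho>2 - x) * W.weight (- x))"
    using nz(1) by (simp add: right_diff_distrib)
  have "CBI_omega \<rho>1 r1 r2
    = 4 * ((\<rho>1 + 1) * (1/2 - r1) + (\<rho>1 + 1) * (1/2 - r2) + (1/2 - r1) * (1/2 - r2))"
    by (simp add: CBI_omega_def field_simps)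
  then have "4 * x\<^sup>2 + CBI_omega \<rho>1 r1 r2
    = 4 * ((1 + 2 * x) * W.weight x + (1 - 2 * x) * W.weight (- x))"
    using W.weight_sum(1)[of x] assms by (simp add: dunkl_poles_def)
  with C have "4 * (2 * x * coeff_C \<rho>1 \<rho>2 r1 r2 x)
    = 4 * ((x - \<rho>2) * (W.weight x + W.weight (- x)))"
    by algebra
  then show "2 * x * coeff_C \<rho>1 \<rho>2 r1 r2 x = (x - \<rho>2) * (W.weight x + W.weight (- x))"
    by (simp add: mult.assoc)
qed

lemma coeff_A_plus_D:
  assumes x: "x \<notin> dunkl_poles"
  shows "coeff_A \<rho>1 \<rho>2 r1 r2 x + coeff_D \<rho>1 \<rho>2 r1 r2 x = (x + \<rho>2) * W.weight x"
proof -
  have "x + 1 \<noteq> 0"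
    using x by (simp add: dunkl_poles_def eq_neg_iff_add_eq_0)
  moreover have "(x + 1) * (coeff_A \<rho>1 \<rho>2 r1 r2 x + coeff_D \<rho>1 \<rho>2 r1 r2 x)
      = (x + 1) * ((x + \<rho>2) * W.weight x)"
    using coeffs_eq_weight(1,4)[OF x] by algebra
  ultimately show ?thesis by simp
qed

text \<open>
  For even \<open>f\<close> the term in \<open>R\<close> cancels against its part in the multiple of the identity,
  \<open>T\<^sup>+ R\<close> merges with \<open>T\<^sup>+\<close>, and the \<open>\<alpha>\<close>-term vanishes.
\<close>
lemma dunkl_D_even:
  assumes x: "x \<notin> dunkl_poles" and f: "\<And>t. f (- t) = f t"
  shows "dunkl_D \<alpha> \<rho>1 \<rho>2 r1 r2 f x = W.L \<rho>2 f x"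
proof -
  have R: "Rop f = f"
    using f by (simp add: Rop_def fun_eq_iff)
  have "dunkl_D \<alpha> \<rho>1 \<rho>2 r1 r2 f x
      = (coeff_A \<rho>1 \<rho>2 r1 r2 x + coeff_D \<rho>1 \<rho>2 r1 r2 x) * (f (x + 1) - f x)
        + coeff_B \<rho>1 \<rho>2 r1 r2 x * (f (x - 1) - f x)"
    by (simp add: dunkl_D_def dunkl_D0_def R Tplus_def Tminus_def algebra_simps)
  also have "\<dots> = W.L \<rho>2 f x"
    by (simp only: coeff_A_plus_D[OF x] coeffs_eq_weight(2)[OF x] W.L_def)
  finally show ?thesis .
qed

text \<open>
  The reflection turns the factor \<open>x - \<rho>\<^sub>2\<close> into \<open>- (x + \<rho>\<^sub>2)\<close>. After this, each of the
  coefficients of \<open>f (x + 1)\<close>, \<open>f (x - 1)\<close> and \<open>f x\<close> contains the factor \<open>x - \<rho>\<^sub>2\<close>, and the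
  quotients are the coefficients of \<open>L (\<rho>\<^sub>2 + 1)\<close>.
\<close>
lemma dunkl_D_odd:
  assumes x: "x \<notin> dunkl_poles" and f: "\<And>t. f (- t) = f t"
  shows "dunkl_D \<alpha> \<rho>1 \<rho>2 r1 r2 (\<lambda>t. (t - \<rho>2) * f t) x
    = (x - \<rho>2) * (W.L (\<rho>2 + 1) f x + \<alpha> * f x)"
proof -
  let ?A = "coeff_A \<rho>1 \<rho>2 r1 r2 x" and ?B = "coeff_B \<rho>1 \<rho>2 r1 r2 x"
  let ?C = "coeff_C \<rho>1 \<rho>2 r1 r2 x" and ?D = "coeff_D \<rho>1 \<rho>2 r1 r2 x"
  let ?h = "\<lambda>t. (t - \<rho>2) * f t"
  have nz: "x + 1 \<noteq> 0" "x \<noteq> 0"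
    using x by (simp_all add: dunkl_poles_def eq_neg_iff_add_eq_0)
  have "(x + 1) * (?A * (x + 1 - \<rho>2) - ?D * (x + 1 + \<rho>2))
      = (x + 1) * ((x - \<rho>2) * (x + \<rho>2 + 1) * W.weight x)"
    using coeffs_eq_weight(1,4)[OF x] by algebra
  then have shift: "?A * (x + 1 - \<rho>2) - ?D * (x + 1 + \<rho>2)
      = (x - \<rho>2) * (x + \<rho>2 + 1) * W.weight x"
    using nz by simp
  have refl: "Rop ?h t = - (t + \<rho>2) * f t" for t
    using f[of t] by (simp add: Rop_def)
  have "dunkl_D0 \<rho>1 \<rho>2 r1 r2 ?h x
      = (?A * (x + 1 - \<rho>2) - ?D * (x + 1 + \<rho>2)) * f (x + 1) + ?B * (x - 1 - \<rho>2) * f (x - 1)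
        - (2 * x * ?C + (?A + ?D + ?B) * (x - \<rho>2)) * f x"
    unfolding dunkl_D0_def Tplus_def Tminus_def refl by algebra
  also have "\<dots> = (x - \<rho>2) * W.L (\<rho>2 + 1) f x"
    unfolding shift coeff_A_plus_D[OF x] coeffs_eq_weight(2,3)[OF x] W.L_def by algebra
  finally have D0: "dunkl_D0 \<rho>1 \<rho>2 r1 r2 ?h x = (x - \<rho>2) * W.L (\<rho>2 + 1) f x" .
  have "?h x - Rop ?h x = 2 * x * f x"
    unfolding refl by algebra
  then have "\<alpha> * ((x - \<rho>2) / (2 * x)) * (?h x - Rop ?h x) = \<alpha> * (x - \<rho>2) * f x"
    using nz by simp
  then show ?thesis
    unfolding dunkl_D_def D0 by algebra
qed

lemma CBI_poly_eigen:
  assumes x: "x \<notin> dunkl_poles"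
  shows "dunkl_D \<alpha> \<rho>1 \<rho>2 r1 r2 (poly (CBI_poly \<rho>1 \<rho>2 r1 r2 n)) x
    = CBI_eigenvalue \<alpha> \<rho>1 \<rho>2 r1 r2 n * poly (CBI_poly \<rho>1 \<rho>2 r1 r2 n) x"
proof -
  define k where "k = n div 2"
  have x': "x \<notin> {0, 1/2, -1/2}"
    using x by (simp add: dunkl_poles_def)
  have s: "W.s = BI_g \<rho>1 \<rho>2 r1 r2 + 2"
    by (simp add: BI_g_def)
  show ?thesis
  proof (cases "even n")
    case True
    then have n: "n = 2 * k" by (simp add: k_def)
    have "poly (CBI_poly \<rho>1 \<rho>2 r1 r2 n) = W.R k"
      using CBI_poly_eq_wilson[of k] by (simp add: n fun_eq_iff)
    then show ?thesis
      using dunkl_D_even[OF x, of "W.R k" \<alpha>] W.R_Q_even W.wilson_eigen(1)[OF x', of k]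
      unfolding CBI_eigenvalue_def Let_def s by (simp add: n power2_eq_square algebra_simps)
  next
    case False
    then have n: "n = Suc (2 * k)" by (simp add: k_def)
    have "poly (CBI_poly \<rho>1 \<rho>2 r1 r2 n) = (\<lambda>t. (t - \<rho>2) * W.Q k t)"
      using CBI_poly_eq_wilson[of k] by (simp add: n fun_eq_iff)
    then show ?thesis
      using dunkl_D_odd[OF x, of "W.Q k" \<alpha>] W.R_Q_even W.wilson_eigen(2)[OF x', of k]
      unfolding CBI_eigenvalue_def Let_def s by (simp add: n power2_eq_square algebra_simps)
  qed
qed

end

theorem theorem1:
  fixes \<rho>1 \<rho>2 r1 r2 \<alpha> :: complex
  assumes "BI_admissible \<rho>1 \<rho>2 r1 r2"
  shows "\<forall>n::nat. \<forall>x::complex. x \<notin> dunkl_poles \<longrightarrow>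
           dunkl_D \<alpha> \<rho>1 \<rho>2 r1 r2 (poly (CBI_poly \<rho>1 \<rho>2 r1 r2 n)) x
             = CBI_eigenvalue \<alpha> \<rho>1 \<rho>2 r1 r2 n * poly (CBI_poly \<rho>1 \<rho>2 r1 r2 n) x"
  using CBI_poly_eigen[OF assms] by blast

end
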